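(* Let $p:\mathbb{R}^n \to \mathbb{R}$ be a function. Then $p$ is difference sublinear if and only if there exist index sets $I$ and $S$ and two bounded families of vectors in $\mathbb{R}^n$, $\{b_{s} \in \mathbb{R}^n \,|\, s \in S\}$ and $\{c_{i} \in \mathbb{R}^n \,|\, i \in I\}$, such that the two-index family $\{a_{is} := b_s - c_i \in \mathbb{R}^n \,|\, i \in I,\ s \in S\}$ satisfies $$p(x) = \inf_{i \in I}\sup_{s \in S}\langle a_{is}, x \rangle = \sup_{s \in S}\inf_{i \in I}\langle a_{is}, x \rangle \quad \forall\, x \in \mathbb{R}^n.$$
   Context: A function $\varphi:\mathbb{R}^n\to\mathbb{R}$ is sublinear if it is convex and positively homogeneous, where positively homogeneous means $\varphi(\lambda x)=\lambda \varphi(x)$ for all $x\in\mathbb{R}^n$ and all real $\lambda>0$. A function $p:\mathbb{R}^n\to\mathbb{R}$ is difference sublinear if $p=\varphi_1-\varphi_2$ for some sublinear functions $\varphi_1,\varphi_2:\mathbb{R}^n\to\mathbb{R}$. $\langle\cdot,\cdot\rangle$ denotes the standard inner product on $\mathbb{R}^n$. The index sets $I$ and $S$ are arbitrary (possibly infinite). Infima and suprema are taken in the extended reals. *)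

theory Defs
  imports "HOL-Analysis.Analysis"
begin

definition sublinear :: "(real ^ 'n \<Rightarrow> real) \<Rightarrow> bool" where
  "sublinear \<phi> \<longleftrightarrow>
     convex_on UNIV \<phi> \<and> (\<forall>t>0. \<forall>x. \<phi> (t *\<^sub>R x) = t * \<phi> x)"

definition difference_sublinear :: "(real ^ 'n \<Rightarrow> real) \<Rightarrow> bool" where
  "difference_sublinear p \<longleftrightarrow>
     (\<exists>\<phi>\<^sub>1 \<phi>\<^sub>2. sublinear \<phi>\<^sub>1 \<and> sublinear \<phi>\<^sub>2 \<and> (\<forall>x. p x = \<phi>\<^sub>1 x - \<phi>\<^sub>2 x))"

(* The infima and suprema are taken in ereal, so an empty index set or a divergent
   supremum can never agree with the finite value p x by convention. *)
definition infsup_representation ::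
  "(real ^ 'n \<Rightarrow> real) \<Rightarrow> 'i set \<Rightarrow> 's set \<Rightarrow> ('s \<Rightarrow> real ^ 'n) \<Rightarrow> ('i \<Rightarrow> real ^ 'n) \<Rightarrow> bool" where
  "infsup_representation p I S b c \<longleftrightarrow>
     bounded (b ` S) \<and> bounded (c ` I) \<and>
     (\<forall>x. ereal (p x) = (INF i\<in>I. SUP s\<in>S. ereal ((b s - c i) \<bullet> x)) \<and>
          ereal (p x) = (SUP s\<in>S. INF i\<in>I. ereal ((b s - c i) \<bullet> x)))"

end

theory Submission
  imports Defs
begin

text \<open>
  The linear term \<open>\<langle>b s - c i, x\<rangle>\<close> separates into a part depending on \<open>s\<close> and a part
  depending on \<open>i\<close>. For such a difference the two suprema decouple, so both \<open>inf sup\<close> and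
  \<open>sup inf\<close> equal \<open>h\<^sub>b x - h\<^sub>c x\<close>, where \<open>h\<^sub>b\<close> and \<open>h\<^sub>c\<close> are the support functions
  of the two families (lemma \<open>infsup_representation_iff\<close>). In other words, there is no genuine
  minimax question, and \<open>p\<close> has a representation precisely if it is a difference of support
  functions of bounded nonempty families.

  It remains to match these with the sublinear functions. A support function is a supremum of
  linear functions and hence sublinear. Conversely, a finite sublinear function \<open>\<phi>\<close> is the support
  function of its subdifferential at the origin, the set of \<open>w\<close> with \<open>\<langle>w, y\<rangle> \<le> \<phi> y\<close>
  for all \<open>y\<close>: separating the strict epigraph of \<open>\<phi>\<close> from a point \<open>(x, \<phi> x)\<close> of the graph
  yields a \<open>w\<close> in this set that is exact at \<open>x\<close>, and continuity of \<open>\<phi>\<close> on the unit sphere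
  bounds the set.
\<close>

section \<open>Extended-real extrema of differences\<close>

lemma SUP_ereal_diff_const:
  fixes f :: "'a \<Rightarrow> real"
  assumes "S \<noteq> {}" and "bdd_above (f ` S)"
  shows "(SUP s\<in>S. ereal (f s - r)) = ereal ((SUP s\<in>S. f s) - r)"
proof (rule SUP_eqI)
  fix s assume "s \<in> S"
  then show "ereal (f s - r) \<le> ereal ((SUP s\<in>S. f s) - r)"
    using assms(2) by (simp add: cSUP_upper)
next
  fix y assume y: "\<And>s. s \<in> S \<Longrightarrow> ereal (f s - r) \<le> y"
  show "ereal ((SUP s\<in>S. f s) - r) \<le> y"
  proof (cases y)
    case (real z)
    have "f s \<le> z + r" if "s \<in> S" for s
      using y[OF that] real by simp
    then have "(SUP s\<in>S. f s) \<le> z + r"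
      using assms(1) by (rule cSUP_least[rotated])
    then show ?thesis using real by simp
  next
    case PInf
    then show ?thesis by simp
  next
    case MInf
    then show ?thesis using y assms(1) by fastforce
  qed
qed

lemma INF_ereal_const_diff:
  fixes g :: "'a \<Rightarrow> real"
  assumes "I \<noteq> {}" and "bdd_above (g ` I)"
  shows "(INF i\<in>I. ereal (r - g i)) = ereal (r - (SUP i\<in>I. g i))"
proof -
  have "(INF i\<in>I. ereal (r - g i)) = (INF i\<in>I. - ereal (g i - r))"
    by simp
  also have "\<dots> = - (SUP i\<in>I. ereal (g i - r))"
    by (rule ereal_INF_uminus_eq)
  also have "\<dots> = ereal (r - (SUP i\<in>I. g i))"
    by (simp add: SUP_ereal_diff_const[OF assms])
  finally show ?thesis .
qed

section \<open>Support functions of bounded families\<close>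

definition support_fun :: "('a \<Rightarrow> real ^ 'n) \<Rightarrow> 'a set \<Rightarrow> real ^ 'n \<Rightarrow> real" where
  "support_fun b S x = (SUP s\<in>S. b s \<bullet> x)"

lemma bdd_above_inner:
  fixes b :: "'a \<Rightarrow> real ^ 'n"
  assumes "bounded (b ` S)"
  shows "bdd_above ((\<lambda>s. b s \<bullet> x) ` S)"
proof -
  obtain K where K: "\<And>s. s \<in> S \<Longrightarrow> norm (b s) \<le> K"
    using assms by (auto simp: bounded_iff)
  have "b s \<bullet> x \<le> K * norm x" if "s \<in> S" for s
    by (rule order_trans[OF norm_cauchy_schwarz]) (simp add: K[OF that] mult_right_mono)
  then show ?thesis by (rule bdd_aboveI2)
qed

lemma sublinear_support_fun:
  fixes b :: "'a \<Rightarrow> real ^ 'n"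
  assumes "S \<noteq> {}" and "bounded (b ` S)"
  shows "sublinear (support_fun b S)"
proof -
  have upper: "b s \<bullet> x \<le> support_fun b S x" if "s \<in> S" for s x
    unfolding support_fun_def using bdd_above_inner[OF assms(2)] that by (rule cSUP_upper2) simp
  have least: "support_fun b S x \<le> z" if "\<And>s. s \<in> S \<Longrightarrow> b s \<bullet> x \<le> z" for x z
    unfolding support_fun_def using assms(1) that by (rule cSUP_least)
  have scale_le: "support_fun b S (t *\<^sub>R x) \<le> t * support_fun b S x" if "t > 0" for t x
    using that by (intro least) (simp add: upper)
  have "support_fun b S (t *\<^sub>R x) = t * support_fun b S x" if "t > 0" for t x
  proof (rule antisym)
    show "support_fun b S (t *\<^sub>R x) \<le> t * support_fun b S x"
      using that by (rule scale_le)
    \<comment> \<open>the reverse inequality is the same one for the factor \<open>1/t\<close>\<close>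
    show "t * support_fun b S x \<le> support_fun b S (t *\<^sub>R x)"
      using scale_le[of "1/t" "t *\<^sub>R x"] that by (simp add: field_simps)
  qed
  moreover have "convex_on UNIV (support_fun b S)"
  proof (rule convex_onI)
    fix t :: real and x y :: "real ^ 'n"
    assume "0 < t" "t < 1"
    then show "support_fun b S ((1 - t) *\<^sub>R x + t *\<^sub>R y)
        \<le> (1 - t) * support_fun b S x + t * support_fun b S y"
      by (intro least) (simp add: inner_add_right upper add_mono mult_left_mono)
  qed simp
  ultimately show ?thesis by (simp add: sublinear_def)
qed

text \<open>
  For fixed \<open>i\<close> the inner supremum is \<open>h\<^sub>b x - \<langle>c i, x\<rangle>\<close>, and for fixed \<open>s\<close> the inner infimum
  is \<open>\<langle>b s, x\<rangle> - h\<^sub>c x\<close>; the outer extremum then yields the same value in both orders. An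
  empty family makes the \<open>inf sup\<close> infinite, so a representation forces both index sets to be
  nonempty.
\<close>

lemma infsup_representation_iff:
  "infsup_representation p I S b c \<longleftrightarrow>
     I \<noteq> {} \<and> S \<noteq> {} \<and> bounded (b ` S) \<and> bounded (c ` I) \<and>
     (\<forall>x. p x = support_fun b S x - support_fun c I x)"
proof -
  have infsup: "(INF i\<in>I. SUP s\<in>S. ereal ((b s - c i) \<bullet> x))
        = ereal (support_fun b S x - support_fun c I x)"
    and supinf: "(SUP s\<in>S. INF i\<in>I. ereal ((b s - c i) \<bullet> x))
        = ereal (support_fun b S x - support_fun c I x)"
    if "I \<noteq> {}" "S \<noteq> {}" "bounded (b ` S)" "bounded (c ` I)" for x
    unfolding inner_diff_left support_fun_def
    by (simp_all only: SUP_ereal_diff_const[OF that(2) bdd_above_inner[OF that(3)]]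
        INF_ereal_const_diff[OF that(1) bdd_above_inner[OF that(4)]])
  have nonempty: "I \<noteq> {}" "S \<noteq> {}" if "infsup_representation p I S b c"
  proof -
    have eq: "ereal (p 0) = (INF i\<in>I. SUP s\<in>S. ereal ((b s - c i) \<bullet> 0))"
      using that by (simp only: infsup_representation_def)
    show "I \<noteq> {}"
      using eq by (auto simp: top_ereal_def)
    then show "S \<noteq> {}"
      using eq by (auto simp: bot_ereal_def)
  qed
  show ?thesis
  proof (cases "I \<noteq> {} \<and> S \<noteq> {} \<and> bounded (b ` S) \<and> bounded (c ` I)")
    case True
    then show ?thesis
      by (simp only: infsup_representation_def infsup supinf ereal.inject simp_thms)
  next
    case False
    then show ?thesis
      using nonempty by (auto simp only: infsup_representation_def)
  qed
qed

section \<open>Sublinear functions are support functions\<close>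

text \<open>The subdifferential at the origin of a sublinear function.\<close>

definition linear_minorants :: "(real ^ 'n \<Rightarrow> real) \<Rightarrow> (real ^ 'n) set" where
  "linear_minorants \<phi> = {w. \<forall>y. w \<bullet> y \<le> \<phi> y}"

lemma sublinear_zero:
  assumes "sublinear \<phi>"
  shows "\<phi> 0 = 0"
proof -
  have "\<phi> (2 *\<^sub>R 0) = 2 * \<phi> 0"
    using assms unfolding sublinear_def by (metis zero_less_numeral)
  then show ?thesis by simp
qed

text \<open>
  Evaluating \<open>\<langle>w, \<cdot>\<rangle> \<le> \<phi>\<close> at the direction of \<open>w\<close> gives \<open>norm w\<close> on the left, and \<open>\<phi>\<close> is
  bounded on the unit sphere because finite convex functions are continuous.
\<close>

lemma bounded_linear_minorants:
  fixes \<phi> :: "real ^ 'n \<Rightarrow> real"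
  assumes "sublinear \<phi>"
  shows "bounded (linear_minorants \<phi>)"
proof -
  have "continuous_on UNIV \<phi>"
    using assms by (intro convex_on_continuous) (auto simp: sublinear_def)
  then have "compact (\<phi> ` sphere 0 1)"
    by (intro compact_continuous_image) (auto intro: continuous_on_subset)
  then obtain K where K: "\<And>y. norm y = 1 \<Longrightarrow> \<phi> y \<le> K"
    by (force dest!: compact_imp_bounded simp: bounded_iff abs_le_iff)
  have "norm w \<le> max K 0" if "w \<in> linear_minorants \<phi>" for w
  proof (cases "w = 0")
    case False
    have "norm w = w \<bullet> sgn w"
      using False by (simp add: sgn_div_norm dot_square_norm power2_eq_square)
    also have "\<dots> \<le> \<phi> (sgn w)"
      using that by (simp add: linear_minorants_def)
    also have "\<dots> \<le> K"
      using False by (intro K) (simp add: norm_sgn)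
    finally show ?thesis by simp
  qed simp
  then show ?thesis by (auto simp: bounded_iff)
qed

text \<open>
  Separating \<open>(x, f x)\<close> from the strict epigraph gives a hyperplane; it is not vertical because
  the domain of \<open>f\<close> is the whole space, so it is the graph of an affine function.
\<close>

lemma convex_on_UNIV_subgradient:
  fixes f :: "'a::euclidean_space \<Rightarrow> real"
  assumes "convex_on UNIV f"
  obtains w where "\<And>y. f x + w \<bullet> (y - x) \<le> f y"
proof -
  define E where "E = {z. f (fst z) < snd z}"
  have "convex E"
  proof (rule convexI)
    fix z z' :: "'a \<times> real" and u v :: real
    assume z: "z \<in> E" "z' \<in> E" and uv: "0 \<le> u" "0 \<le> v" "u + v = 1"
    have "f (u *\<^sub>R fst z + v *\<^sub>R fst z') \<le> u * f (fst z) + v * f (fst z')"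
      using assms uv by (simp add: convex_on_def)
    also have "\<dots> < u * snd z + v * snd z'"
    proof (cases "u = 0")
      case True
      then show ?thesis using z uv by (simp add: E_def)
    next
      case False
      then show ?thesis
        using z uv by (intro add_less_le_mono mult_strict_left_mono mult_left_mono)
          (auto simp: E_def)
    qed
    finally show "u *\<^sub>R z + v *\<^sub>R z' \<in> E" by (simp add: E_def)
  qed
  moreover have "(x, f x + 1) \<in> E" and "{(x, f x)} \<inter> E = {}"
    by (auto simp: E_def)
  ultimately have "\<exists>a \<beta>. a \<noteq> 0 \<and> (\<forall>z\<in>{(x, f x)}. a \<bullet> z \<le> \<beta>) \<and> (\<forall>z\<in>E. \<beta> \<le> a \<bullet> z)"
    by (intro separating_hyperplane_sets) (simp_all, blast)
  then obtain a \<beta> where "a \<noteq> 0" and below: "a \<bullet> (x, f x) \<le> \<beta>"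
    and above: "\<And>z. z \<in> E \<Longrightarrow> \<beta> \<le> a \<bullet> z"
    by (metis singletonI)
  obtain u \<alpha> where a: "a = (u, \<alpha>)" by (cases a)
  have sep: "u \<bullet> x + \<alpha> * f x \<le> u \<bullet> y + \<alpha> * t" if "f y < t" for y t
    using below above[of "(y, t)"] that by (simp add: a E_def)
  have "\<alpha> \<ge> 0"
    using sep[of x "f x + 1"] by (simp add: algebra_simps)
  have "\<alpha> \<noteq> 0"
  proof
    assume "\<alpha> = 0"
    have "u \<bullet> x \<le> u \<bullet> (x - u)"
      using sep[of "x - u" "f (x - u) + 1"] \<open>\<alpha> = 0\<close> by simp
    then have "u \<bullet> u \<le> 0"
      by (simp add: inner_diff_right)
    then have "u = 0"
      by (metis inner_gt_zero_iff not_less)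
    then show False
      using \<open>a \<noteq> 0\<close> \<open>\<alpha> = 0\<close> by (simp add: a zero_prod_def)
  qed
  with \<open>\<alpha> \<ge> 0\<close> have "\<alpha> > 0" by simp
  have "f x + (- (1 / \<alpha>) *\<^sub>R u) \<bullet> (y - x) \<le> f y" for y
  proof (rule dense_ge)
    fix t assume "f y < t"
    then show "f x + (- (1 / \<alpha>) *\<^sub>R u) \<bullet> (y - x) \<le> t"
      using sep[of y t] \<open>\<alpha> > 0\<close> by (simp add: field_simps inner_diff_right)
  qed
  then show ?thesis by (rule that)
qed

text \<open>
  A subgradient \<open>w\<close> at \<open>x\<close> bounds \<open>\<phi> - \<langle>w, \<cdot>\<rangle>\<close> below by its value at \<open>x\<close>. This difference is
  positively homogeneous, so being bounded below it is nonnegative; and its value at \<open>0\<close> is \<open>0\<close>,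
  so its value at \<open>x\<close> is at most \<open>0\<close>.
\<close>

lemma sublinear_exact_minorant:
  fixes \<phi> :: "real ^ 'n \<Rightarrow> real"
  assumes "sublinear \<phi>"
  obtains w where "w \<in> linear_minorants \<phi>" and "w \<bullet> x = \<phi> x"
proof -
  have "convex_on UNIV \<phi>" using assms by (simp add: sublinear_def)
  then obtain w where w: "\<And>y. \<phi> x + w \<bullet> (y - x) \<le> \<phi> y"
    using convex_on_UNIV_subgradient[of \<phi> x] by metis
  define m where "m = \<phi> x - w \<bullet> x"
  have lower: "m \<le> \<phi> y - w \<bullet> y" for y
    using w[of y] by (simp add: m_def inner_diff_right)
  have "m \<le> 0"
    using lower[of 0] sublinear_zero[OF assms] by simp
  have minorant: "w \<bullet> y \<le> \<phi> y" for y
  proof (rule ccontr)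
    assume "\<not> w \<bullet> y \<le> \<phi> y"
    then have d: "w \<bullet> y - \<phi> y > 0" by simp
    \<comment> \<open>scaling \<open>y\<close> by this factor takes the difference to the value \<open>m - 1\<close>\<close>
    define t where "t = (1 - m) / (w \<bullet> y - \<phi> y)"
    have "t > 0" using d \<open>m \<le> 0\<close> by (simp add: t_def)
    then have "\<phi> (t *\<^sub>R y) = t * \<phi> y"
      using assms by (simp add: sublinear_def)
    then have "m \<le> - (t * (w \<bullet> y - \<phi> y))"
      using lower[of "t *\<^sub>R y"] by (simp add: algebra_simps)
    also have "\<dots> = m - 1"
      using d by (simp add: t_def)
    finally show False by simp
  qed
  moreover have "w \<bullet> x = \<phi> x"
    using \<open>m \<le> 0\<close> minorant[of x] by (simp add: m_def)
  ultimately show ?thesis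
    by (intro that) (simp_all add: linear_minorants_def)
qed

lemma linear_minorants_nonempty:
  assumes "sublinear \<phi>"
  shows "linear_minorants \<phi> \<noteq> {}"
  using sublinear_exact_minorant[OF assms] by blast

lemma sublinear_eq_support_fun:
  assumes "sublinear \<phi>"
  shows "support_fun (\<lambda>w. w) (linear_minorants \<phi>) x = \<phi> x"
proof -
  obtain w where "w \<in> linear_minorants \<phi>" "w \<bullet> x = \<phi> x"
    using sublinear_exact_minorant[OF assms] .
  then show ?thesis
    unfolding support_fun_def
    by (intro cSup_eq_maximum) (auto simp: linear_minorants_def intro: rev_image_eqI)
qed

section \<open>Difference sublinear functions\<close>

lemma difference_sublinear_if_representation:
  assumes "infsup_representation p I S b c"
  shows "difference_sublinear p"
  using assms sublinear_support_fun
  unfolding infsup_representation_iff difference_sublinear_def by metis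

lemma representation_if_difference_sublinear:
  assumes "difference_sublinear p"
  obtains I S where "infsup_representation p I S (\<lambda>w. w) (\<lambda>w. w)"
proof -
  obtain \<phi>\<^sub>1 \<phi>\<^sub>2 where \<phi>: "sublinear \<phi>\<^sub>1" "sublinear \<phi>\<^sub>2" and p: "\<And>x. p x = \<phi>\<^sub>1 x - \<phi>\<^sub>2 x"
    using assms by (auto simp: difference_sublinear_def)
  have "infsup_representation p (linear_minorants \<phi>\<^sub>2) (linear_minorants \<phi>\<^sub>1) (\<lambda>w. w) (\<lambda>w. w)"
    unfolding infsup_representation_iff
    by (simp add: \<phi> p linear_minorants_nonempty bounded_linear_minorants sublinear_eq_support_fun)
  then show ?thesis by (rule that)
qed

(* HOL cannot quantify existentially over types, so the equivalence draws its index sets from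
   the type of vectors; a family enters the representation only through its set of values, so
   this is no restriction. The second conjunct gives the "if" part for index sets of any types. *)
theorem theorem3:
  fixes p :: "real ^ 'n \<Rightarrow> real"
  shows "(difference_sublinear p \<longleftrightarrow>
            (\<exists>(I :: (real ^ 'n) set) (S :: (real ^ 'n) set) b c. infsup_representation p I S b c)) \<and>
         (\<forall>(I :: 'i set) (S :: 's set) b c.
            infsup_representation p I S b c \<longrightarrow> difference_sublinear p)"
proof (intro conjI iffI allI impI)
  assume "difference_sublinear p"
  then show "\<exists>(I :: (real ^ 'n) set) (S :: (real ^ 'n) set) b c. infsup_representation p I S b c"
    using representation_if_difference_sublinear by blast
qed (auto intro: difference_sublinear_if_representation)

end
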